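(* Let $n\ge2$. Every Carter diagram of type $B_n$ is obtained by the following construction: take a Carter diagram $\Gamma$ of type $A_n$; choose a vertex $v$ of $\Gamma$ such that $\Gamma\setminus\{v\}$ is still connected; give all edges adjacent with $v$ weight $2$ (i.e. replace each by a double edge), keeping all other edges of weight $1$.
   Context: For a crystallographic root system and linearly independent roots $\beta_1,\dots,\beta_m$, the Carter diagram has vertices $\beta_i$, distinct $\beta_i,\beta_j$ joined by $\frac{2(\beta_i\mid\beta_j)}{(\beta_i\mid\beta_i)}\cdot\frac{2(\beta_j\mid\beta_i)}{(\beta_j\mid\beta_j)}$ edges (the weight); its type is the Dynkin type of the smallest root subsystem containing the $\beta_i$. A Carter diagram of type $A_n$ is, equivalently, a connected graph on $n$ vertices that is a union of complete subgraphs $\Gamma_1,\dots,\Gamma_k$, any two meeting in at most one vertex, every vertex in at most two of them, with $\sum_i(|\Gamma_i|-1)=n-1$. *)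

theory Defs
  imports "HOL-Analysis.Analysis"
begin

definition cartan_number :: "'a::real_inner \<Rightarrow> 'a \<Rightarrow> real" where
  "cartan_number \<alpha> \<beta> = 2 * (\<alpha> \<bullet> \<beta>) / (\<beta> \<bullet> \<beta>)"

text \<open>Reduced crystallographic root systems. The Euclidean space of which \<open>\<Phi>\<close> is a root
  system is \<open>span \<Phi>\<close>, which may be smaller than the ambient type, so that a subsystem
  of smaller rank is again a root system.\<close>

definition root_system :: "'a::euclidean_space set \<Rightarrow> bool" where
  "root_system \<Phi> \<longleftrightarrow>
     finite \<Phi> \<and> 0 \<notin> \<Phi> \<and>
     (\<forall>\<alpha>\<in>\<Phi>. \<forall>c::real. c *\<^sub>R \<alpha> \<in> \<Phi> \<longrightarrow> c = 1 \<or> c = -1) \<and>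
     (\<forall>\<alpha>\<in>\<Phi>. \<forall>\<beta>\<in>\<Phi>. \<beta> - cartan_number \<beta> \<alpha> *\<^sub>R \<alpha> \<in> \<Phi>) \<and>
     (\<forall>\<alpha>\<in>\<Phi>. \<forall>\<beta>\<in>\<Phi>. cartan_number \<alpha> \<beta> \<in> \<int>)"

definition root_subsystem :: "'a::euclidean_space set \<Rightarrow> 'a set \<Rightarrow> bool" where
  "root_subsystem \<Phi> \<Psi> \<longleftrightarrow> \<Psi> \<subseteq> \<Phi> \<and> root_system \<Psi>"

definition root_base :: "'a::euclidean_space set \<Rightarrow> 'a set \<Rightarrow> bool" where
  "root_base \<Phi> \<Delta> \<longleftrightarrow>
     \<Delta> \<subseteq> \<Phi> \<and> independent \<Delta> \<and>
     (\<forall>\<beta>\<in>\<Phi>. \<exists>k::'a \<Rightarrow> int.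
        \<beta> = (\<Sum>\<delta>\<in>\<Delta>. of_int (k \<delta>) *\<^sub>R \<delta>) \<and>
        ((\<forall>\<delta>\<in>\<Delta>. 0 \<le> k \<delta>) \<or> (\<forall>\<delta>\<in>\<Delta>. k \<delta> \<le> 0)))"

text \<open>Dynkin types are given by Cartan matrices, with simple roots indexed by \<open>{..<n}\<close> and
  \<open>(i, j)\<close> entry \<open>2 (\<alpha>\<^sub>i | \<alpha>\<^sub>j) / (\<alpha>\<^sub>j | \<alpha>\<^sub>j)\<close>. In type B the last
  simple root is the short one.\<close>

definition cartan_A :: "nat \<Rightarrow> nat \<Rightarrow> int" where
  "cartan_A i j = (if i = j then 2 else if i = Suc j \<or> j = Suc i then -1 else 0)"

definition cartan_B :: "nat \<Rightarrow> nat \<Rightarrow> nat \<Rightarrow> int" where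
  "cartan_B n i j = (if i + 2 = n \<and> j + 1 = n then -2 else cartan_A i j)"

definition has_dynkin_type :: "'a::euclidean_space set \<Rightarrow> nat \<Rightarrow> (nat \<Rightarrow> nat \<Rightarrow> int) \<Rightarrow> bool" where
  "has_dynkin_type \<Phi> n C \<longleftrightarrow>
     (\<exists>\<alpha>::nat \<Rightarrow> 'a. inj_on \<alpha> {..<n} \<and> root_base \<Phi> (\<alpha> ` {..<n}) \<and>
        (\<forall>i<n. \<forall>j<n. cartan_number (\<alpha> i) (\<alpha> j) = of_int (C i j)))"

text \<open>\<open>mult \<Gamma> u v\<close> is the number of edges joining \<open>u\<close> and \<open>v\<close>.\<close>

record 'v diagram =
  verts :: "'v set"
  mult :: "'v \<Rightarrow> 'v \<Rightarrow> nat"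

definition delete_vertex :: "'v diagram \<Rightarrow> 'v \<Rightarrow> 'v diagram" where
  "delete_vertex \<Gamma> v =
     \<lparr>verts = verts \<Gamma> - {v},
      mult = (\<lambda>x y. if x = v \<or> y = v then 0 else mult \<Gamma> x y)\<rparr>"

definition diagram_connected :: "'v diagram \<Rightarrow> bool" where
  "diagram_connected \<Gamma> \<longleftrightarrow>
     verts \<Gamma> \<noteq> {} \<and>
     (\<forall>u\<in>verts \<Gamma>. \<forall>v\<in>verts \<Gamma>.
        (u, v) \<in> {(x, y). x \<in> verts \<Gamma> \<and> y \<in> verts \<Gamma> \<and> mult \<Gamma> x y \<noteq> 0}\<^sup>*)"

definition double_at :: "'v diagram \<Rightarrow> 'v \<Rightarrow> 'v diagram" where
  "double_at \<Gamma> v =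
     \<lparr>verts = verts \<Gamma>,
      mult = (\<lambda>x y. if (x = v \<or> y = v) \<and> mult \<Gamma> x y \<noteq> 0 then 2 else mult \<Gamma> x y)\<rparr>"

text \<open>\<open>\<beta>\<close> labels the vertices of the abstract diagram \<open>\<Gamma>\<close> by roots. Multiplicities are
  required to vanish off the vertex set and on the diagonal, so that equality of diagrams is
  equality of labelled weighted graphs.\<close>

definition is_carter_diagram ::
    "'a::euclidean_space set \<Rightarrow> ('v \<Rightarrow> 'a) \<Rightarrow> 'v diagram \<Rightarrow> bool" where
  "is_carter_diagram \<Phi> \<beta> \<Gamma> \<longleftrightarrow>
     root_system \<Phi> \<and> \<beta> ` verts \<Gamma> \<subseteq> \<Phi> \<and>
     inj_on \<beta> (verts \<Gamma>) \<and> independent (\<beta> ` verts \<Gamma>) \<and>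
     (\<forall>u v. real (mult \<Gamma> u v) =
        (if u \<in> verts \<Gamma> \<and> v \<in> verts \<Gamma> \<and> u \<noteq> v
         then cartan_number (\<beta> u) (\<beta> v) * cartan_number (\<beta> v) (\<beta> u) else 0))"

text \<open>The type argument names the ambient space of the realising root system, since HOL cannot
  quantify over it. The hull is the smallest root subsystem of \<open>\<Phi>\<close> containing the labels.\<close>

definition carter_diagram_of_type ::
    "'a::euclidean_space itself \<Rightarrow> nat \<Rightarrow> (nat \<Rightarrow> nat \<Rightarrow> int) \<Rightarrow> 'v diagram \<Rightarrow> bool" where
  "carter_diagram_of_type _ n C \<Gamma> \<longleftrightarrow>
     (\<exists>(\<Phi>::'a set) \<beta>. is_carter_diagram \<Phi> \<beta> \<Gamma> \<and>
        has_dynkin_type (root_subsystem \<Phi> hull (\<beta> ` verts \<Gamma>)) n C)"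

end

theory Submission imports Defs begin

text \<open>In coordinates, the hull of the labels consists of roots \<open>\<plusminus>e\<^sub>i\<close> and \<open>\<plusminus>e\<^sub>i \<plusminus> e\<^sub>j\<close> of an
  orthogonal frame. Read a long label \<open>\<plusminus>e\<^sub>i \<plusminus> e\<^sub>j\<close> as an edge between the indices \<open>i\<close> and \<open>j\<close>.
  Since the hull is irreducible, the edges connect all \<open>n\<close> indices, and since it has short roots,
  some label is short; as there are at most \<open>n\<close> labels, the edges form a tree and exactly one
  label is short. Changing signs in the frame turns the long labels into \<open>e\<^sub>i - e\<^sub>j\<close> and
  the short one into \<open>e\<^sub>r\<close>. Completing the frame by a point \<open>f\<^sub>n\<close> to a regular simplex and
  replacing \<open>e\<^sub>r\<close> by \<open>e\<^sub>r - f\<^sub>n\<close> gives a diagram of type \<open>A\<^sub>n\<close> with the same adjacencies, in which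
  deleting that vertex leaves the line graph of a tree.\<close>

section \<open>Reflections, root subsystems and their hulls\<close>

lemma reflection_norm_invariant:
  fixes x y :: "'a::euclidean_space"
  assumes "y \<noteq> 0"
  shows "(x - cartan_number x y *\<^sub>R y) \<bullet> (x - cartan_number x y *\<^sub>R y) = x \<bullet> x"
proof -
  have "cartan_number x y * (y \<bullet> y) = 2 * (x \<bullet> y)"
    using assms by (simp add: cartan_number_def)
  then show ?thesis
    by (simp add: inner_diff_left inner_diff_right inner_commute[of y x])
qed

text \<open>Finiteness, reducedness and integrality pass to subsets, so closure under reflections is
  all that has to be checked.\<close>

lemma root_subsystemI:
  assumes "root_system \<Phi>" "T \<subseteq> \<Phi>"
    and "\<And>x y. x \<in> T \<Longrightarrow> y \<in> T \<Longrightarrow> y - cartan_number y x *\<^sub>R x \<in> T"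
  shows "root_subsystem \<Phi> T"
  unfolding root_subsystem_def root_system_def
proof (intro conjI ballI allI impI)
  show "T \<subseteq> \<Phi>" by fact
  show "finite T" using finite_subset[OF assms(2)] assms(1) by (simp add: root_system_def)
  show "0 \<notin> T" using assms(1,2) unfolding root_system_def by auto
  show "c = 1 \<or> c = -1" if "\<alpha> \<in> T" "c *\<^sub>R \<alpha> \<in> T" for \<alpha> c
    using assms(1) that[THEN subsetD[OF assms(2)]] by (simp add: root_system_def)
  show "cartan_number \<alpha> \<beta> \<in> \<int>" if "\<alpha> \<in> T" "\<beta> \<in> T" for \<alpha> \<beta>
    using assms(1) that[THEN subsetD[OF assms(2)]] by (simp add: root_system_def)
qed (rule assms(3))

text \<open>An intersection of sets closed under their own reflections is again closed, and \<Phi>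
  itself is one of the sets intersected, which keeps the hull inside \<Phi>.\<close>

lemma root_subsystem_hull:
  assumes "root_system \<Phi>" "S \<subseteq> \<Phi>"
  shows "root_subsystem \<Phi> (root_subsystem \<Phi> hull S)"
proof (rule root_subsystemI[OF assms(1)])
  have "root_subsystem \<Phi> \<Phi>"
    using assms by (simp add: root_subsystem_def)
  then show "root_subsystem \<Phi> hull S \<subseteq> \<Phi>"
    using assms by (intro hull_minimal)
  show "y - cartan_number y x *\<^sub>R x \<in> root_subsystem \<Phi> hull S"
    if "x \<in> root_subsystem \<Phi> hull S" "y \<in> root_subsystem \<Phi> hull S" for x y
    unfolding hull_def
  proof (rule InterI)
    fix \<Psi> assume \<Psi>: "\<Psi> \<in> {\<Psi>. root_subsystem \<Phi> \<Psi> \<and> S \<subseteq> \<Psi>}"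
    then have "x \<in> \<Psi>" "y \<in> \<Psi>" using that by (simp_all add: hull_def)
    then show "y - cartan_number y x *\<^sub>R x \<in> \<Psi>"
      using \<Psi> by (simp add: root_subsystem_def root_system_def)
  qed
qed

text \<open>Reflections stay in a linear subspace, so \<open>\<Phi> \<inter> span S\<close> is a
  subsystem that competes in the hull.\<close>

lemma root_hull_subset_span:
  assumes "root_system \<Phi>" "S \<subseteq> \<Phi>"
  shows "root_subsystem \<Phi> hull S \<subseteq> span S"
proof -
  have "root_subsystem \<Phi> (\<Phi> \<inter> span S)"
  proof (rule root_subsystemI[OF assms(1)])
    show "y - cartan_number y x *\<^sub>R x \<in> \<Phi> \<inter> span S"
      if "x \<in> \<Phi> \<inter> span S" "y \<in> \<Phi> \<inter> span S" for x y
      using that assms(1) by (auto simp: root_system_def intro: span_diff span_scale)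
  qed auto
  then have "root_subsystem \<Phi> hull S \<subseteq> \<Phi> \<inter> span S"
    using assms by (intro hull_minimal) (auto intro: span_base)
  then show ?thesis by blast
qed

lemma root_system_uminus:
  assumes "root_system \<Phi>" "x \<in> \<Phi>"
  shows "- x \<in> \<Phi>"
proof -
  have "x \<noteq> 0" "x - cartan_number x x *\<^sub>R x \<in> \<Phi>"
    using assms by (auto simp: root_system_def)
  moreover have "x - cartan_number x x *\<^sub>R x = - x"
    using \<open>x \<noteq> 0\<close> by (simp add: cartan_number_def scaleR_2)
  ultimately show ?thesis by simp
qed

section \<open>Orthogonal frames and the coordinates of roots\<close>

locale orthogonal_frame =
  fixes e :: "nat \<Rightarrow> 'a::euclidean_space" and N :: real and n :: nat
  assumes N_pos: "N > 0"
    and inner_frame: "i < n \<Longrightarrow> j < n \<Longrightarrow> e i \<bullet> e j = (if i = j then N else 0)"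
begin

lemma inj_frame: "inj_on e {..<n}"
proof (rule inj_onI)
  fix i j assume "i \<in> {..<n}" "j \<in> {..<n}" "e i = e j"
  then show "i = j"
    using inner_frame[of i j] inner_frame[of j j] N_pos by (auto split: if_splits)
qed

lemma independent_frame: "independent (e ` {..<n})"
proof (rule pairwise_orthogonal_independent)
  show "pairwise orthogonal (e ` {..<n})"
    by (auto simp: pairwise_def orthogonal_def inner_frame)
  show "0 \<notin> e ` {..<n}"
  proof
    assume "0 \<in> e ` {..<n}"
    then obtain i where "i < n" "e i = 0" by force
    then show False using inner_frame[of i i] N_pos by simp
  qed
qed

lemma inner_frame_sum:
  assumes "j < n"
  shows "(\<Sum>i<n. c i *\<^sub>R e i) \<bullet> e j = c j * N"
proof -
  have "(\<Sum>i<n. c i *\<^sub>R e i) \<bullet> e j = (\<Sum>i<n. if i = j then c j * N else 0)"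
    unfolding inner_sum_left using assms by (intro sum.cong) (auto simp: inner_frame)
  also have "\<dots> = c j * N" using assms by simp
  finally show ?thesis .
qed

lemma inner_sum_sum:
  "(\<Sum>i<n. c i *\<^sub>R e i) \<bullet> (\<Sum>i<n. d i *\<^sub>R e i) = N * (\<Sum>i<n. c i * d i)"
proof -
  have "(\<Sum>i<n. c i *\<^sub>R e i) \<bullet> (\<Sum>i<n. d i *\<^sub>R e i)
      = (\<Sum>j<n. d j * ((\<Sum>i<n. c i *\<^sub>R e i) \<bullet> e j))"
    by (simp add: inner_sum_right)
  also have "\<dots> = (\<Sum>j<n. N * (c j * d j))"
    by (intro sum.cong refl) (simp add: inner_frame_sum)
  finally show ?thesis by (simp add: sum_distrib_left)
qed

text \<open>Integrality of \<open>cartan_number (e i) x\<close> says that the squared norm of the coordinate vector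
  of \<open>x\<close> divides twice each of its coordinates.\<close>

lemma integral_root_form:
  assumes \<Psi>: "root_system \<Psi>" and e: "\<And>i. i < n \<Longrightarrow> e i \<in> \<Psi>" and x: "x \<in> \<Psi>"
    and xc: "x = (\<Sum>i<n. of_int (c i) *\<^sub>R e i)"
  shows "(\<exists>i<n. \<exists>s\<in>{1,-1}. x = s *\<^sub>R e i) \<or>
    (\<exists>i<n. \<exists>j<n. i \<noteq> j \<and> (\<exists>s\<in>{1,-1}. \<exists>t\<in>{1,-1}. x = s *\<^sub>R e i + t *\<^sub>R e j))"
proof -
  define Q where "Q = (\<Sum>i<n. c i * c i)"
  have xx: "x \<bullet> x = N * of_int Q"
    unfolding xc inner_sum_sum by (simp add: Q_def)
  have "x \<noteq> 0" using \<Psi> x by (auto simp: root_system_def)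
  then have "N * of_int Q > 0" by (simp flip: xx)
  then have Q_pos: "Q > 0" using N_pos by (simp add: zero_less_mult_iff)
  have bound: "Q \<le> 2 * \<bar>c i\<bar>" if i: "i < n" "c i \<noteq> 0" for i
  proof -
    have "cartan_number (e i) x \<in> \<int>"
      using \<Psi> x e[OF i(1)] by (auto simp: root_system_def)
    moreover have "e i \<bullet> x = of_int (c i) * N"
      using inner_frame_sum[OF i(1), of "\<lambda>i. of_int (c i)"] by (simp add: xc inner_commute)
    ultimately have "2 * of_int (c i) / of_int Q \<in> (\<int>::real set)"
      using N_pos by (simp add: cartan_number_def xx field_simps)
    then obtain m where "2 * of_int (c i) / of_int Q = (of_int m :: real)"
      by (elim Ints_cases)
    then have "2 * of_int (c i) = (of_int (m * Q) :: real)"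
      using Q_pos by (simp add: field_simps)
    then have "2 * c i = m * Q" by linarith
    then have "Q dvd 2 * c i" by simp
    then show ?thesis using i(2) dvd_imp_le_int[of "2 * c i" Q] by (simp add: abs_mult)
  qed
  have single: "c i * c i \<le> Q" if "i < n" for i
    unfolding Q_def using that by (intro member_le_sum) auto
  have pair: "c i * c i + c j * c j \<le> Q" if "i < n" "j < n" "i \<noteq> j" for i j
  proof -
    have "(\<Sum>k\<in>{i,j}. c k * c k) \<le> Q"
      unfolding Q_def using that by (intro sum_mono2) auto
    then show ?thesis using that by simp
  qed
  have triple: "c i * c i + c j * c j + c k * c k \<le> Q"
    if "i < n" "j < n" "k < n" "i \<noteq> j" "k \<noteq> i" "k \<noteq> j" for i j k
  proof -
    have "(\<Sum>k\<in>{i,j,k}. c k * c k) \<le> Q"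
      unfolding Q_def using that by (intro sum_mono2) auto
    then show ?thesis using that by simp
  qed
  have sq1: "c i * c i \<ge> 1" if "c i \<noteq> 0" for i
    using that by (metis int_one_le_iff_zero_less not_real_square_gt_zero of_int_mult
        of_int_0_less_iff of_int_eq_0_iff)
  \<comment> \<open>Here \<open>c i * c i \<le> Q \<le> 2 * \<bar>c i\<bar>\<close>.\<close>
  have small: "\<bar>c i\<bar> \<le> 2" if "i < n" for i
  proof (cases "c i = 0")
    case False
    have "\<bar>c i\<bar> * \<bar>c i\<bar> \<le> 2 * \<bar>c i\<bar>"
      using single[OF that] bound[OF that False] by (simp add: abs_mult_self_eq)
    then show ?thesis
      by (rule mult_right_le_imp_le) (use False in simp)
  qed simp
  obtain i where i: "i < n" "c i \<noteq> 0"
  proof (rule ccontr)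
    assume "\<not> thesis"
    then have "Q = 0" unfolding Q_def using that by (intro sum.neutral) auto
    then show False using Q_pos by simp
  qed
  have restrict: "x = (\<Sum>k\<in>A. of_int (c k) *\<^sub>R e k)"
    if "A \<subseteq> {..<n}" "\<And>k. k < n \<Longrightarrow> k \<notin> A \<Longrightarrow> c k = 0" for A
    unfolding xc using that by (intro sum.mono_neutral_right) auto
  show ?thesis
  proof (cases "\<exists>j<n. j \<noteq> i \<and> c j \<noteq> 0")
    case False
    then have x_i: "x = of_int (c i) *\<^sub>R e i" using restrict[of "{i}"] i by auto
    \<comment> \<open>With a single nonzero coordinate, divisibility still admits 2 and -2;
      reducedness excludes them.\<close>
    have reduced: "\<forall>\<alpha>\<in>\<Psi>. \<forall>a. a *\<^sub>R \<alpha> \<in> \<Psi> \<longrightarrow> a = 1 \<or> a = -1"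
      using \<Psi> unfolding root_system_def by (elim conjE)
    have "of_int (c i) = (1::real) \<or> of_int (c i) = (-1::real)"
      by (rule reduced[rule_format, OF e[OF i(1)] x[unfolded x_i]])
    then show ?thesis using i(1) x_i by auto
  next
    case True
    then obtain j where j: "j < n" "j \<noteq> i" "c j \<noteq> 0" by blast
    \<comment> \<open>A second nonzero coordinate adds at least 1 to \<open>Q\<close>, and
      \<open>\<bar>c k\<bar> * \<bar>c k\<bar> + 1 \<le> 2 * \<bar>c k\<bar>\<close> leaves only
      absolute value 1. Then \<open>Q \<le> 2\<close>, which rules out a third nonzero
      coordinate.\<close>
    have unit: "c k = 1 \<or> c k = -1" if k: "k < n" "l < n" "k \<noteq> l" "c k \<noteq> 0" "c l \<noteq> 0" for k l
    proof -
      have le: "\<bar>c k\<bar> * \<bar>c k\<bar> + 1 \<le> 2 * \<bar>c k\<bar>"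
        using pair[OF k(1-3)] bound[OF k(1) k(4)] sq1[OF k(5)] by (simp add: abs_mult_self_eq)
      have "\<bar>c k\<bar> \<noteq> 2"
      proof
        assume "\<bar>c k\<bar> = 2"
        then show False using le by simp
      qed
      then show ?thesis using small[OF k(1)] k(4) by linarith
    qed
    have ci: "c i = 1 \<or> c i = -1" using unit[of i j] i j by auto
    have cj: "c j = 1 \<or> c j = -1" using unit[of j i] i j by auto
    have "c k = 0" if "k < n" "k \<notin> {i, j}" for k
    proof (rule ccontr)
      assume "c k \<noteq> 0"
      then have "3 \<le> Q"
        using triple[of i j k] sq1[of i] sq1[of j] sq1[of k] i j that by auto
      then show False using bound[OF i] ci by auto
    qed
    then have "x = of_int (c i) *\<^sub>R e i + of_int (c j) *\<^sub>R e j"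
      using restrict[of "{i, j}"] i j by auto
    then show ?thesis using ci cj i j by fastforce
  qed
qed


text \<open>This is irreducibility of the hull. If no root of \<open>S\<close> had coordinates both
  in \<open>K\<close> and outside it, the roots of \<Psi> supported on one side would form a
  subsystem containing \<open>S\<close>, hence all of \<Psi>. But the roots
  \<open>e i - e (Suc i)\<close> chain all indices together.\<close>

lemma root_hull_crosses:
  assumes \<Phi>: "root_system \<Phi>" "S \<subseteq> \<Phi>" and \<Psi>: "\<Psi> = root_subsystem \<Phi> hull S"
    and coords: "\<And>x. x \<in> \<Psi> \<Longrightarrow> \<exists>c. x = (\<Sum>i<n. c i *\<^sub>R e i)"
    and simple: "\<And>i. Suc i < n \<Longrightarrow> e i - e (Suc i) \<in> \<Psi>"
    and K: "K \<subseteq> {..<n}" "K \<noteq> {}" "K \<noteq> {..<n}"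
  shows "\<exists>x\<in>S. (\<exists>i\<in>K. x \<bullet> e i \<noteq> 0) \<and> (\<exists>j\<in>{..<n} - K. x \<bullet> e j \<noteq> 0)"
proof (rule ccontr)
  assume no_cross: "\<not> ?thesis"
  define inside where "inside x \<longleftrightarrow> (\<forall>j\<in>{..<n} - K. x \<bullet> e j = 0)" for x
  define outside where "outside x \<longleftrightarrow> (\<forall>i\<in>K. x \<bullet> e i = 0)" for x
  define T where "T = {x \<in> \<Psi>. inside x \<or> outside x}"
  have \<Psi>_sub: "root_subsystem \<Phi> \<Psi>" unfolding \<Psi> using \<Phi> by (rule root_subsystem_hull)
  then have \<Psi>_root: "root_system \<Psi>" and "\<Psi> \<subseteq> \<Phi>" by (auto simp: root_subsystem_def)
  have orth: "x \<bullet> y = 0" if "x \<in> \<Psi>" "inside x" "outside y" for x y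
  proof -
    from coords[OF \<open>x \<in> \<Psi>\<close>] obtain c where c: "x = (\<Sum>i<n. c i *\<^sub>R e i)" by blast
    have "c i * (e i \<bullet> y) = 0" if "i < n" for i
    proof (cases "i \<in> K")
      case True
      then show ?thesis using \<open>outside y\<close> by (simp add: outside_def inner_commute)
    next
      case False
      then have "c i * N = 0"
        using \<open>inside x\<close> that inner_frame_sum[OF that, of c] by (simp add: inside_def c)
      then show ?thesis using N_pos by simp
    qed
    then show ?thesis unfolding c inner_sum_left by (intro sum.neutral) simp
  qed
  have "root_subsystem \<Psi> T"
  proof (rule root_subsystemI[OF \<Psi>_root])
    fix x y assume xy: "x \<in> T" "y \<in> T"
    then have "y - cartan_number y x *\<^sub>R x \<in> \<Psi>"
      using \<Psi>_root by (simp add: T_def root_system_def)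
    \<comment> \<open>Reflection in an orthogonal root changes nothing. Roots that are not
      orthogonal lie on the same side, and their linear combinations stay there.\<close>
    moreover have "inside (y - cartan_number y x *\<^sub>R x) \<or> outside (y - cartan_number y x *\<^sub>R x)"
    proof (cases "x \<bullet> y = 0")
      case True
      then show ?thesis using xy by (simp add: T_def cartan_number_def inner_commute)
    next
      case False
      then have "inside x \<and> inside y \<or> outside x \<and> outside y"
        using xy orth[of x y] orth[of y x] by (auto simp: T_def inner_commute)
      then show ?thesis by (auto simp: inside_def outside_def inner_diff_left)
    qed
    ultimately show "y - cartan_number y x *\<^sub>R x \<in> T" by (simp add: T_def)
  qed (simp add: T_def)
  then have "root_subsystem \<Phi> T" using \<open>\<Psi> \<subseteq> \<Phi>\<close> by (auto simp: root_subsystem_def)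
  moreover have "S \<subseteq> T"
    using no_cross hull_subset[of S "root_subsystem \<Phi>"]
    unfolding T_def inside_def outside_def \<Psi> by blast
  ultimately have "\<Psi> \<subseteq> T" unfolding \<Psi> by (intro hull_minimal)
  \<comment> \<open>The root \<open>e i - e (Suc i)\<close> has both coordinates nonzero, so being
    on one side puts both indices on that side.\<close>
  have step: "i \<in> K \<longleftrightarrow> Suc i \<in> K" if i: "Suc i < n" for i
  proof -
    have "inside (e i - e (Suc i)) \<or> outside (e i - e (Suc i))"
      using \<open>\<Psi> \<subseteq> T\<close> simple[OF i] by (auto simp: T_def)
    moreover have "(e i - e (Suc i)) \<bullet> e i \<noteq> 0" "(e i - e (Suc i)) \<bullet> e (Suc i) \<noteq> 0"
      using i N_pos by (simp_all add: inner_diff_left inner_frame)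
    ultimately show ?thesis using i unfolding inside_def outside_def
      by (metis DiffI Suc_lessD lessThan_iff)
  qed
  have "i \<in> K \<longleftrightarrow> 0 \<in> K" if "i < n" for i
    using that
  proof (induction i)
    case (Suc i)
    then show ?case using step[of i] by simp
  qed simp
  then show False using K by (metis equals0I lessThan_iff subsetD subset_antisym subsetI)
qed

text \<open>Starting from the vertex of a short root, each crossing edge enlarges the set \<open>K\<close> of
  indices reached and fixes the sign of the new index. Reaching all of \<open>{..<n}\<close> uses up
  \<open>n - 1\<close> long roots, so no other label remains.\<close>

lemma signed_tree:
  fixes \<beta> :: "'v \<Rightarrow> 'a"
  assumes V: "finite V" "card V \<le> n" "v\<^sub>0 \<in> V"
    and r: "r < n" and s\<^sub>0: "s\<^sub>0 \<in> {1, -1}" and \<beta>\<^sub>0: "\<beta> v\<^sub>0 = s\<^sub>0 *\<^sub>R e r"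
    and cross: "\<And>K. K \<subseteq> {..<n} \<Longrightarrow> K \<noteq> {} \<Longrightarrow> K \<noteq> {..<n} \<Longrightarrow>
      \<exists>v\<in>V. \<exists>i\<in>K. \<exists>j\<in>{..<n} - K. \<exists>s\<in>{1,-1}. \<exists>t\<in>{1,-1}. \<beta> v = s *\<^sub>R e i + t *\<^sub>R e j"
  obtains \<epsilon> where "\<And>i. \<epsilon> i \<in> {1, -1::real}" "\<epsilon> r = s\<^sub>0"
    "\<And>v. v \<in> V - {v\<^sub>0} \<Longrightarrow> \<exists>i<n. \<exists>j<n. i \<noteq> j \<and> \<beta> v = \<epsilon> i *\<^sub>R e i - \<epsilon> j *\<^sub>R e j"
proof -
  \<comment> \<open>A partial tree: \<open>K\<close> holds its \<open>k\<close> indices,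
    \<open>W\<close> the vertices labelled by its \<open>k - 1\<close> edges, and \<epsilon> signs
    that turn each of these labels into a difference.\<close>
  define reached where "reached k K W \<epsilon> \<longleftrightarrow>
      K \<subseteq> {..<n} \<and> card K = k \<and> r \<in> K \<and> W \<subseteq> V - {v\<^sub>0} \<and> card W = k - 1 \<and>
      (\<forall>i. \<epsilon> i \<in> {1, -1::real}) \<and> \<epsilon> r = s\<^sub>0 \<and>
      (\<forall>v\<in>W. \<exists>i\<in>K. \<exists>j\<in>K. i \<noteq> j \<and> \<beta> v = \<epsilon> i *\<^sub>R e i - \<epsilon> j *\<^sub>R e j)" for k K W \<epsilon>
  have grow: "\<exists>K W \<epsilon>. reached k K W \<epsilon>" if "1 \<le> k" "k \<le> n" for k
    using that
  proof (induction k rule: nat_induct_at_least)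
    case base
    show ?case
      using r s\<^sub>0 by (intro exI[of _ "{r}"] exI[of _ "{}"] exI[of _ "\<lambda>_. s\<^sub>0"])
        (auto simp: reached_def)
  next
    case (Suc k)
    then obtain K W \<epsilon> where KW: "reached k K W \<epsilon>" by force
    then have K: "K \<subseteq> {..<n}" "card K = k" "r \<in> K"
      and W: "W \<subseteq> V - {v\<^sub>0}" "card W = k - 1"
      and \<epsilon>: "\<epsilon> i \<in> {1, -1::real}" "\<epsilon> r = s\<^sub>0"
      and WK: "v \<in> W \<Longrightarrow> \<exists>i\<in>K. \<exists>j\<in>K. i \<noteq> j \<and> \<beta> v = \<epsilon> i *\<^sub>R e i - \<epsilon> j *\<^sub>R e j" for i v
      by (auto simp: reached_def)
    have "K \<noteq> {..<n}" using K Suc.prems by auto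
    then obtain v i j s t where v: "v \<in> V" "i \<in> K" "j < n" "j \<notin> K"
      and st: "s \<in> {1, -1}" "t \<in> {1, -1}" and \<beta>v: "\<beta> v = s *\<^sub>R e i + t *\<^sub>R e j"
      using cross[of K] K by blast
    have ij: "i < n" "i \<noteq> j" and jr: "j \<noteq> r" using v K by auto
    have \<beta>j: "\<beta> v \<bullet> e j \<noteq> 0"
      using st N_pos ij v(3) by (auto simp: \<beta>v inner_add_left inner_frame)
    have "v \<noteq> v\<^sub>0" using \<beta>j \<beta>\<^sub>0 r v(3) jr by (auto simp: inner_frame)
    have "v \<notin> W"
    proof
      assume "v \<in> W"
      then obtain i' j' where "i' \<in> K" "j' \<in> K" "\<beta> v = \<epsilon> i' *\<^sub>R e i' - \<epsilon> j' *\<^sub>R e j'"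
        using WK by blast
      moreover from this have "i' < n" "j' < n" "i' \<noteq> j" "j' \<noteq> j" using K v by auto
      ultimately show False using \<beta>j v(3) by (simp add: inner_diff_left inner_frame)
    qed
    \<comment> \<open>The sign at \<open>i\<close> is already fixed. If
      \<open>s = \<epsilon> i\<close>, the new sign is \<open>- t\<close> and the label is the
      difference from \<open>i\<close> to \<open>j\<close>; if \<open>s = - \<epsilon> i\<close>, it
      is \<open>t\<close> and the difference is the reverse one.\<close>
    define \<epsilon>' where "\<epsilon>' = \<epsilon>(j := - t * s * \<epsilon> i)"
    have \<epsilon>': "\<epsilon>' m = \<epsilon> m" if "m \<in> K" for m using that v(4) by (auto simp: \<epsilon>'_def)
    have range: "\<epsilon>' m \<in> {1, -1}" for m
      using st \<epsilon>(1)[of m] \<epsilon>(1)[of i] by (auto simp: \<epsilon>'_def)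
    have new: "\<beta> v = \<epsilon>' i *\<^sub>R e i - \<epsilon>' j *\<^sub>R e j \<or> \<beta> v = \<epsilon>' j *\<^sub>R e j - \<epsilon>' i *\<^sub>R e i"
      using st \<epsilon>(1)[of i] ij by (auto simp: \<epsilon>'_def \<beta>v)
    have fin: "finite K" "finite W" using K W V by (auto intro: finite_subset)
    have "reached (Suc k) (insert j K) (insert v W) \<epsilon>'"
      unfolding reached_def
    proof (intro conjI ballI allI)
      show "insert j K \<subseteq> {..<n}" "r \<in> insert j K" "insert v W \<subseteq> V - {v\<^sub>0}"
        using K v W \<open>v \<noteq> v\<^sub>0\<close> by auto
      show "card (insert j K) = Suc k" using K fin v by simp
      show "card (insert v W) = Suc k - 1" using W fin \<open>v \<notin> W\<close> Suc.hyps by simp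
      show "\<epsilon>' m \<in> {1, -1}" for m by (rule range)
      show "\<epsilon>' r = s\<^sub>0" using \<epsilon>' K \<epsilon> by simp
      show "\<exists>i\<in>insert j K. \<exists>l\<in>insert j K. i \<noteq> l \<and> \<beta> w = \<epsilon>' i *\<^sub>R e i - \<epsilon>' l *\<^sub>R e l"
        if w: "w \<in> insert v W" for w
      proof (cases "w = v")
        case True
        from new show ?thesis
        proof
          assume "\<beta> v = \<epsilon>' i *\<^sub>R e i - \<epsilon>' j *\<^sub>R e j"
          then show ?thesis
            using True v(2) ij(2) by (intro bexI[of _ i] bexI[of _ j]) simp_all
        next
          assume "\<beta> v = \<epsilon>' j *\<^sub>R e j - \<epsilon>' i *\<^sub>R e i"
          then show ?thesis
            using True v(2) ij(2) by (intro bexI[of _ j] bexI[of _ i]) simp_all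
        qed
      next
        case False
        then obtain i' j' where "i' \<in> K" "j' \<in> K" "i' \<noteq> j'"
          "\<beta> w = \<epsilon> i' *\<^sub>R e i' - \<epsilon> j' *\<^sub>R e j'"
          using w WK[of w] by blast
        then show ?thesis
          by (intro bexI[of _ i'] bexI[of _ j'] insertI2) (simp_all add: \<epsilon>')
      qed
    qed
    then show ?case by blast
  qed
  obtain K W \<epsilon> where "reached n K W \<epsilon>" using grow[of n] r by auto
  then have K: "K \<subseteq> {..<n}" and W: "W \<subseteq> V - {v\<^sub>0}" "card W = n - 1"
    and \<epsilon>: "\<epsilon> i \<in> {1, -1::real}" "\<epsilon> r = s\<^sub>0"
    and WK: "v \<in> W \<Longrightarrow> \<exists>i\<in>K. \<exists>j\<in>K. i \<noteq> j \<and> \<beta> v = \<epsilon> i *\<^sub>R e i - \<epsilon> j *\<^sub>R e j" for i v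
    by (auto simp: reached_def)
  have "W = V - {v\<^sub>0}"
    using V W by (intro card_seteq) auto
  show thesis
  proof (rule that[of \<epsilon>])
    show "\<exists>i<n. \<exists>j<n. i \<noteq> j \<and> \<beta> v = \<epsilon> i *\<^sub>R e i - \<epsilon> j *\<^sub>R e j" if "v \<in> V - {v\<^sub>0}" for v
    proof -
      obtain i j where "i \<in> K" "j \<in> K" "i \<noteq> j" "\<beta> v = \<epsilon> i *\<^sub>R e i - \<epsilon> j *\<^sub>R e j"
        using WK[of v] \<open>W = V - {v\<^sub>0}\<close> \<open>v \<in> V - {v\<^sub>0}\<close> by blast
      then show ?thesis using K by blast
    qed
  qed (fact \<epsilon>)+
qed

end

section \<open>An orthogonal frame of short roots in type \<open>B\<close>\<close>

lemma abel_sum: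
  fixes e :: "nat \<Rightarrow> 'a::real_vector"
  shows "(\<Sum>i<m. a i *\<^sub>R (e i - e (Suc i))) =
    (\<Sum>i<m. (a i - (if i = 0 then 0 else a (i - 1))) *\<^sub>R e i) - (if m = 0 then 0 else a (m - 1)) *\<^sub>R e m"
  by (induction m) (simp_all add: algebra_simps)

text \<open>The Cartan matrix determines the Gram matrix of the simple roots up to the scale
  \<open>N\<close>, the squared length of the last one. The frame consists of the tail sums of the
  simple roots, as in the standard coordinates where \<alpha> is a difference of consecutive frame
  vectors, except for the last one, which is a frame vector itself.\<close>

lemma B_type_frame:
  fixes \<Psi> :: "'a::euclidean_space set"
  assumes \<Psi>: "root_system \<Psi>" and n: "n \<ge> 2" and type: "has_dynkin_type \<Psi> n (cartan_B n)"
  shows "\<exists>e N. orthogonal_frame e N n \<and> (\<forall>i<n. e i \<in> \<Psi>) \<and>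
    (\<forall>i. Suc i < n \<longrightarrow> e i - e (Suc i) \<in> \<Psi>) \<and>
    (\<forall>x\<in>\<Psi>. \<exists>c::nat \<Rightarrow> int. x = (\<Sum>i<n. of_int (c i) *\<^sub>R e i))"
proof -
  obtain \<alpha> where inj: "inj_on \<alpha> {..<n}" and base: "root_base \<Psi> (\<alpha> ` {..<n})"
    and cartan: "\<And>i j. i < n \<Longrightarrow> j < n \<Longrightarrow> cartan_number (\<alpha> i) (\<alpha> j) = of_int (cartan_B n i j)"
    using type unfolding has_dynkin_type_def by blast
  have mem: "\<alpha> i \<in> \<Psi>" if "i < n" for i
    using base that by (auto simp: root_base_def)
  have pos: "\<alpha> i \<bullet> \<alpha> i > 0" if "i < n" for i
  proof -
    have "\<alpha> i \<noteq> 0" using \<Psi> mem[OF that] by (auto simp: root_system_def)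
    then show ?thesis by simp
  qed
  have ip: "2 * (\<alpha> i \<bullet> \<alpha> j) = of_int (cartan_B n i j) * (\<alpha> j \<bullet> \<alpha> j)" if "i < n" "j < n" for i j
    using cartan[OF that] pos[OF that(2)] by (simp add: cartan_number_def field_simps)
  define N where "N = \<alpha> (n - 1) \<bullet> \<alpha> (n - 1)"
  have N: "N > 0" unfolding N_def using pos n by simp
  \<comment> \<open>Comparing the two Cartan entries of adjacent simple roots gives the ratio of
    their squared lengths: 2 at the end of the chain, 1 elsewhere. The induction runs downwards from
    \<open>n - 2\<close>.\<close>
  have "i \<le> n - 2 \<longrightarrow> \<alpha> i \<bullet> \<alpha> i = 2 * N" for i
  proof
    assume "i \<le> n - 2"
    then show "\<alpha> i \<bullet> \<alpha> i = 2 * N"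
    proof (induction rule: inc_induct)
      case base
      have "n - 1 = Suc (n - 2)" "Suc (n - 2) < n" "Suc (Suc (n - 2)) = n" using n by simp_all
      then show ?case
        using ip[of "n - 2" "n - 1"] ip[of "n - 1" "n - 2"] n
        by (simp add: cartan_B_def cartan_A_def N_def inner_commute)
    next
      case (step k)
      then have "k < n" "Suc k < n" "Suc (Suc k) \<noteq> n" by auto
      with step.IH show ?case
        using ip[of k "Suc k"] ip[of "Suc k" k] n
        by (simp add: cartan_B_def cartan_A_def inner_commute)
    qed
  qed
  then have norm: "\<alpha> i \<bullet> \<alpha> i = 2 * N" if "Suc i < n" for i
    using that by simp
  have gram: "\<alpha> i \<bullet> \<alpha> j = N * (if i = j then if Suc i = n then 1 else 2
      else if j = Suc i \<or> i = Suc j then -1 else 0)" if ij: "i < n" "j < n" for i j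
  proof (cases "Suc j = n")
    case True
    then have "\<alpha> j \<bullet> \<alpha> j = N" by (auto simp: N_def)
    then show ?thesis using ip[OF ij] True ij by (auto simp: cartan_B_def cartan_A_def)
  next
    case False
    then have "\<alpha> j \<bullet> \<alpha> j = 2 * N" using norm ij by auto
    then show ?thesis using ip[OF ij] False ij by (auto simp: cartan_B_def cartan_A_def)
  qed
  \<comment> \<open>The empty sum \<open>e n = 0\<close> makes
    \<open>\<alpha> i = e i - e (Suc i)\<close> hold for the last simple root too.\<close>
  define e where "e i = (\<Sum>j\<in>{i..<n}. \<alpha> j)" for i
  have e_rec: "e i = \<alpha> i + e (Suc i)" if "i < n" for i
    using that by (simp add: e_def sum.atLeast_Suc_lessThan)
  have e_last: "e n = 0" "e (n - 1) = \<alpha> (n - 1)"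
    using e_rec[of "n - 1"] n by (simp_all add: e_def)
  have e\<alpha>: "e i \<bullet> \<alpha> j = N * (of_bool (i = j) - of_bool (i = Suc j))" if "i \<le> n - 1" "j < n" for i j
    using that(1)
  proof (induction rule: inc_induct)
    case base
    show ?case unfolding e_last using gram[of "n - 1" j] that n by auto
  next
    case (step k)
    then show ?case using gram[of k j] that n e_rec[of k]
      by (auto simp: inner_add_left algebra_simps)
  qed
  have ee: "e i \<bullet> e j = (if i = j then N else 0)" if "j \<le> n - 1" "i < n" for i j
    using that(1)
  proof (induction rule: inc_induct)
    case base
    show ?case unfolding e_last using e\<alpha>[of i "n - 1"] that n by auto
  next
    case (step k)
    then show ?case using e\<alpha>[of i k] that n e_rec[of k]
      by (auto simp: inner_add_right algebra_simps)
  qed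
  have frame: "orthogonal_frame e N n"
    by unfold_locales (use N ee in auto)
  \<comment> \<open>Going down from the simple root \<open>e (n - 1)\<close>, the reflection of
    \<open>e (Suc k)\<close> in \<open>\<alpha> k\<close> is \<open>e k\<close>.\<close>
  have e_mem: "e i \<in> \<Psi>" if "i \<le> n - 1" for i
    using that
  proof (induction rule: inc_induct)
    case base
    show ?case unfolding e_last using mem n by simp
  next
    case (step k)
    then have "cartan_number (e (Suc k)) (\<alpha> k) = -1"
      using e\<alpha>[of "Suc k" k] norm[of k] N by (simp add: cartan_number_def)
    moreover have "e (Suc k) - cartan_number (e (Suc k)) (\<alpha> k) *\<^sub>R \<alpha> k \<in> \<Psi>"
      using \<Psi> step mem[of k] by (simp add: root_system_def)
    ultimately show ?case using e_rec[of k] step by (simp add: add.commute[of "\<alpha> k"])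
  qed
  have \<alpha>_diff: "\<alpha> i = e i - e (Suc i)" if "i < n" for i
    using e_rec[OF that] by simp
  have coords: "\<exists>c::nat \<Rightarrow> int. x = (\<Sum>i<n. of_int (c i) *\<^sub>R e i)" if "x \<in> \<Psi>" for x
  proof -
    have "\<forall>x\<in>\<Psi>. \<exists>k::'a \<Rightarrow> int. x = (\<Sum>\<delta>\<in>\<alpha> ` {..<n}. of_int (k \<delta>) *\<^sub>R \<delta>) \<and>
        ((\<forall>\<delta>\<in>\<alpha> ` {..<n}. 0 \<le> k \<delta>) \<or> (\<forall>\<delta>\<in>\<alpha> ` {..<n}. k \<delta> \<le> 0))"
      using base unfolding root_base_def by (elim conjE)
    from bspec[OF this that] obtain k :: "'a \<Rightarrow> int"
      where "x = (\<Sum>\<delta>\<in>\<alpha> ` {..<n}. of_int (k \<delta>) *\<^sub>R \<delta>)" by (elim exE conjE)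
    also have "\<dots> = (\<Sum>i<n. of_int (k (\<alpha> i)) *\<^sub>R \<alpha> i)"
      by (simp add: sum.reindex[OF inj])
    also have "\<dots> = (\<Sum>i<n. of_int (k (\<alpha> i)) *\<^sub>R (e i - e (Suc i)))"
      by (intro sum.cong refl) (simp flip: \<alpha>_diff)
    \<comment> \<open>Summation by parts; the boundary term vanishes because
      \<open>e n = 0\<close>.\<close>
    also have "\<dots> = (\<Sum>i<n. of_int (k (\<alpha> i) - (if i = 0 then 0 else k (\<alpha> (i - 1)))) *\<^sub>R e i)"
      using abel_sum[of "\<lambda>i. of_int (k (\<alpha> i))" e n]
      by (simp add: e_last(1) if_distrib[of of_int] cong: if_cong)
    finally show ?thesis
      by (rule exI[where x = "\<lambda>i. k (\<alpha> i) - (if i = 0 then 0 else k (\<alpha> (i - 1)))"])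
  qed
  show ?thesis
  proof (intro exI[of _ e] exI[of _ N] conjI allI impI ballI frame)
    show "e i \<in> \<Psi>" if "i < n" for i using e_mem that by simp
    show "e i - e (Suc i) \<in> \<Psi>" if "Suc i < n" for i using \<alpha>_diff[of i] mem[of i] that by simp
  qed (rule coords)
qed

section \<open>The root system of type \<open>A\<close> on the vertices of a regular simplex\<close>

definition A_roots :: "(nat \<Rightarrow> 'a::euclidean_space) \<Rightarrow> nat \<Rightarrow> 'a set" where
  "A_roots f n = {f i - f j | i j. i \<le> n \<and> j \<le> n \<and> i \<noteq> j}"

text \<open>Only differences of points are constrained. Asking for \<open>n + 1\<close> orthogonal
  vectors, as in the usual model of type \<open>A\<close>, could exceed the dimension of the ambient
  space.\<close>

locale simplex_points =
  fixes f :: "nat \<Rightarrow> 'a::euclidean_space" and N :: real and n :: nat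
  assumes N_pos: "N > 0"
    and inner_diff_diff: "i \<le> n \<Longrightarrow> j \<le> n \<Longrightarrow> k \<le> n \<Longrightarrow> l \<le> n \<Longrightarrow>
      (f i - f j) \<bullet> (f k - f l) =
        N * (of_bool (i = k) + of_bool (j = l) - of_bool (i = l) - of_bool (j = k))"
begin

lemma norm_diff: "i \<le> n \<Longrightarrow> j \<le> n \<Longrightarrow> i \<noteq> j \<Longrightarrow> (f i - f j) \<bullet> (f i - f j) = 2 * N"
  using inner_diff_diff[of i j i j] by simp

lemma cartan_diff_diff:
  assumes "i \<le> n" "j \<le> n" "k \<le> n" "l \<le> n" "k \<noteq> l"
  shows "cartan_number (f i - f j) (f k - f l) =
    of_bool (i = k) + of_bool (j = l) - of_bool (i = l) - of_bool (j = k)"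
  using norm_diff[of k l] inner_diff_diff[of i j k l] assms N_pos
  by (simp add: cartan_number_def)

lemma A_rootsE:
  assumes "x \<in> A_roots f n"
  obtains i j where "i \<le> n" "j \<le> n" "i \<noteq> j" "x = f i - f j"
  using assms unfolding A_roots_def by blast

lemma A_rootsI: "i \<le> n \<Longrightarrow> j \<le> n \<Longrightarrow> i \<noteq> j \<Longrightarrow> f i - f j \<in> A_roots f n"
  unfolding A_roots_def by blast

lemma root_system_A_roots: "root_system (A_roots f n)"
  unfolding root_system_def
proof (intro conjI ballI allI impI)
  have "A_roots f n \<subseteq> (\<lambda>(i, j). f i - f j) ` ({..n} \<times> {..n})"
    unfolding A_roots_def by auto
  then show "finite (A_roots f n)" by (rule finite_subset) simp
  have norm: "x \<bullet> x = 2 * N" if "x \<in> A_roots f n" for x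
    using that by (elim A_rootsE) (simp add: norm_diff)
  show "0 \<notin> A_roots f n" using norm[of 0] N_pos by auto
  show "c = 1 \<or> c = -1" if "x \<in> A_roots f n" "c *\<^sub>R x \<in> A_roots f n" for x c
  proof -
    have "c * c * (2 * N) = 2 * N" using norm[OF that(1)] norm[OF that(2)] by simp
    then have "c * c = 1" using N_pos by simp
    then show ?thesis by (simp add: square_eq_1_iff)
  qed
  show "cartan_number x y \<in> \<int>" if "x \<in> A_roots f n" "y \<in> A_roots f n" for x y
    using that by (elim A_rootsE) (simp add: cartan_diff_diff)
  show "y - cartan_number y x *\<^sub>R x \<in> A_roots f n"
    if x: "x \<in> A_roots f n" and y: "y \<in> A_roots f n" for x y
  proof -
    obtain i j where ij: "i \<le> n" "j \<le> n" "i \<noteq> j" "x = f i - f j" using x by (rule A_rootsE)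
    obtain k l where kl: "k \<le> n" "l \<le> n" "k \<noteq> l" "y = f k - f l" using y by (rule A_rootsE)
    \<comment> \<open>The reflection in \<open>f i - f j\<close> acts on the roots by transposing
      the indices \<open>i\<close> and \<open>j\<close>.\<close>
    define swap where "swap m = (if m = i then j else if m = j then i else m)" for m
    have "y - cartan_number y x *\<^sub>R x = f (swap k) - f (swap l)"
      using ij kl by (auto simp: cartan_diff_diff swap_def scaleR_2)
    then show ?thesis using ij kl by (auto simp: swap_def intro!: A_rootsI)
  qed
qed

text \<open>The two given roots have Cartan number -1, so reflecting one in the other adds
  them.\<close>

lemma root_system_diff_trans:
  assumes \<Psi>: "root_system \<Psi>" "f i - f j \<in> \<Psi>" "f j - f k \<in> \<Psi>"
    and ijk: "i \<le> n" "j \<le> n" "k \<le> n" "i \<noteq> j" "j \<noteq> k" "i \<noteq> k"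
  shows "f i - f k \<in> \<Psi>"
proof -
  have "(f i - f j) - cartan_number (f i - f j) (f j - f k) *\<^sub>R (f j - f k) \<in> \<Psi>"
    using \<Psi> by (simp add: root_system_def)
  then show ?thesis using ijk by (simp add: cartan_diff_diff)
qed

text \<open>With \<open>f i - f j\<close> read as an edge, \<open>cross\<close> says that the edges
  from \<open>S\<close> connect every point to \<open>n\<close>. The hull is closed under composing
  edges, so it contains all of them.\<close>

lemma A_roots_hull:
  assumes S: "S \<subseteq> A_roots f n"
    and cross: "\<And>K. K \<subseteq> {..n} \<Longrightarrow> n \<in> K \<Longrightarrow> K \<noteq> {..n} \<Longrightarrow>
      \<exists>i\<in>K. \<exists>j\<in>{..n} - K. f i - f j \<in> S \<or> f j - f i \<in> S"
  shows "root_subsystem (A_roots f n) hull S = A_roots f n"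
proof
  let ?\<Psi> = "root_subsystem (A_roots f n) hull S"
  have sub: "root_subsystem (A_roots f n) ?\<Psi>"
    using root_system_A_roots S by (rule root_subsystem_hull)
  then show "?\<Psi> \<subseteq> A_roots f n" by (simp add: root_subsystem_def)
  have \<Psi>: "root_system ?\<Psi>" using sub by (simp add: root_subsystem_def)
  have minus: "f j - f i \<in> ?\<Psi>" if "f i - f j \<in> ?\<Psi>" for i j
    using root_system_uminus[OF \<Psi> that] by simp
  have S_sub: "S \<subseteq> ?\<Psi>" by (rule hull_subset)
  define K where "K = {i. i \<le> n \<and> (i = n \<or> f i - f n \<in> ?\<Psi>)}"
  have "K = {..n}"
  proof (rule ccontr)
    assume "K \<noteq> {..n}"
    then obtain i j where ij: "i \<in> K" "j \<in> {..n} - K" "f i - f j \<in> S \<or> f j - f i \<in> S"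
      using cross[of K] by (auto simp: K_def)
    then have "f j - f i \<in> ?\<Psi>" using S_sub minus by blast
    moreover have "i \<noteq> j" "j \<noteq> n" using ij by (auto simp: K_def)
    ultimately have "f j - f n \<in> ?\<Psi>"
      using ij root_system_diff_trans[OF \<Psi>, of j i n] by (cases "i = n") (auto simp: K_def)
    then show False using ij by (auto simp: K_def)
  qed
  then have to_n: "f i - f n \<in> ?\<Psi>" if "i < n" for i using that by (auto simp: K_def)
  show "A_roots f n \<subseteq> ?\<Psi>"
  proof
    fix x assume "x \<in> A_roots f n"
    then obtain i j where ij: "i \<le> n" "j \<le> n" "i \<noteq> j" "x = f i - f j" by (rule A_rootsE)
    show "x \<in> ?\<Psi>"
    proof (cases "i = n \<or> j = n")
      case True
      then show ?thesis using ij to_n[of i] to_n[of j] minus by auto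
    next
      case False
      then show ?thesis
        using ij to_n[of i] to_n[of j] minus root_system_diff_trans[OF \<Psi>, of i n j] by auto
    qed
  qed
qed

text \<open>The simple roots are the consecutive differences. Their independence is obtained by
  counting: they are \<open>n\<close> vectors spanning a set of dimension at least
  \<open>n\<close>.\<close>

lemma A_roots_dynkin_type:
  assumes dim: "n \<le> dim (A_roots f n)"
  shows "has_dynkin_type (A_roots f n) n cartan_A"
proof -
  define \<alpha> where "\<alpha> i = f i - f (Suc i)" for i
  have cartan: "cartan_number (\<alpha> i) (\<alpha> j) = of_int (cartan_A i j)" if "i < n" "j < n" for i j
    using that by (auto simp: \<alpha>_def cartan_diff_diff cartan_A_def)
  have inj: "inj_on \<alpha> {..<n}"
  proof (rule inj_onI)
    fix i j assume ij: "i \<in> {..<n}" "j \<in> {..<n}" "\<alpha> i = \<alpha> j"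
    then have "cartan_A i j = 2"
      using cartan[of i j] cartan[of j j] by (simp add: cartan_A_def)
    then show "i = j" by (simp add: cartan_A_def split: if_splits)
  qed
  \<comment> \<open>A telescoping sum. The coefficients are functions of the vector, as
    \<open>root_base\<close> asks, and injectivity of \<alpha> translates them to indices.\<close>
  have expand: "f i - f j = (\<Sum>\<delta>\<in>\<alpha> ` {..<n}. of_int (of_bool (\<delta> \<in> \<alpha> ` {i..<j})) *\<^sub>R \<delta>)"
    if "i \<le> j" "j \<le> n" for i j
  proof -
    have "(\<Sum>\<delta>\<in>\<alpha> ` {..<n}. of_int (of_bool (\<delta> \<in> \<alpha> ` {i..<j})) *\<^sub>R \<delta>) = (\<Sum>\<delta>\<in>\<alpha> ` {i..<j}. \<delta>)"
      using that by (intro sum.mono_neutral_cong_right) auto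
    also have "\<dots> = (\<Sum>m\<in>{i..<j}. \<alpha> m)"
      using that by (subst sum.reindex) (auto intro: inj_on_subset[OF inj])
    also have "\<dots> = f i - f j"
      unfolding \<alpha>_def using sum_Suc_diff'[OF that(1), of "\<lambda>i. - f i"] by simp
    finally show ?thesis by simp
  qed
  have coeffs: "\<exists>k::'a \<Rightarrow> int. x = (\<Sum>\<delta>\<in>\<alpha> ` {..<n}. of_int (k \<delta>) *\<^sub>R \<delta>) \<and>
      ((\<forall>\<delta>\<in>\<alpha> ` {..<n}. 0 \<le> k \<delta>) \<or> (\<forall>\<delta>\<in>\<alpha> ` {..<n}. k \<delta> \<le> 0))"
    if "x \<in> A_roots f n" for x
  proof -
    obtain i j where ij: "i \<le> n" "j \<le> n" "i \<noteq> j" "x = f i - f j" using \<open>x \<in> A_roots f n\<close> by (rule A_rootsE)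
    show ?thesis
    proof (cases "i < j")
      case True
      then show ?thesis using expand[of i j] ij
        by (intro exI[of _ "\<lambda>\<delta>. of_bool (\<delta> \<in> \<alpha> ` {i..<j})"]) auto
    next
      case False
      have "x = - (f j - f i)" using ij by simp
      also have "\<dots> = (\<Sum>\<delta>\<in>\<alpha> ` {..<n}. of_int (- of_bool (\<delta> \<in> \<alpha> ` {j..<i})) *\<^sub>R \<delta>)"
        using False ij by (subst expand) (auto simp: sum_negf)
      finally show ?thesis
        by (intro exI[of _ "\<lambda>\<delta>. - of_bool (\<delta> \<in> \<alpha> ` {j..<i})"]) auto
    qed
  qed
  have sub: "\<alpha> ` {..<n} \<subseteq> A_roots f n"
    by (auto simp: \<alpha>_def intro!: A_rootsI)
  have "A_roots f n \<subseteq> span (\<alpha> ` {..<n})"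
  proof
    fix x assume "x \<in> A_roots f n"
    from coeffs[OF this] obtain k :: "'a \<Rightarrow> int"
      where "x = (\<Sum>\<delta>\<in>\<alpha> ` {..<n}. of_int (k \<delta>) *\<^sub>R \<delta>)" by (elim exE conjE)
    then show "x \<in> span (\<alpha> ` {..<n})" by (auto intro: span_sum span_scale span_base)
  qed
  then have "independent (\<alpha> ` {..<n})"
    using sub dim card_image[OF inj] by (intro card_le_dim_spanning[of _ "A_roots f n"]) auto
  then have "root_base (A_roots f n) (\<alpha> ` {..<n})"
    unfolding root_base_def using sub coeffs by (intro conjI ballI)
  then show ?thesis
    unfolding has_dynkin_type_def using inj cartan by blast
qed

end

text \<open>The point \<open>f n\<close> completes the frame to a regular simplex without leaving the span of the
  frame; its height \<open>s\<close> over the frame solves \<open>n s\<^sup>2 = 2 s + 1\<close>.\<close>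

lemma (in orthogonal_frame) simplex_extension:
  assumes n: "n \<ge> 1"
  obtains f where "\<And>i. i < n \<Longrightarrow> f i = e i" "simplex_points f N n" "n \<le> dim (A_roots f n)"
proof -
  define s where "s = (1 + sqrt (1 + real n)) / real n"
  define E where "E = (\<Sum>i<n. e i)"
  define f where "f i = (if i < n then e i else s *\<^sub>R E)" for i
  have ns: "real n * s = 1 + sqrt (1 + real n)" using n by (simp add: s_def)
  have "(real n * s - 1)\<^sup>2 = 1 + real n" by (simp add: ns)
  then have "real n * (real n * s\<^sup>2) = real n * (2 * s + 1)"
    by (simp add: power2_eq_square algebra_simps)
  then have s: "real n * s\<^sup>2 = 2 * s + 1" using n by simp
  have Ee: "E \<bullet> e i = N" if "i < n" for i
    using inner_frame_sum[OF that, of "\<lambda>_. 1"] by (simp add: E_def)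
  have EE: "E \<bullet> E = real n * N"
    using inner_sum_sum[of "\<lambda>_. 1" "\<lambda>_. 1"] by (simp add: E_def)
  have apex: "(e i - s *\<^sub>R E) \<bullet> (e i - s *\<^sub>R E) = 2 * N" if "i < n" for i
  proof -
    have "(e i - s *\<^sub>R E) \<bullet> (e i - s *\<^sub>R E) = N - 2 * s * N + (real n * s\<^sup>2) * N"
      using that by (simp add: inner_diff_left inner_diff_right inner_commute[of "e i" E] Ee EE
          inner_frame power2_eq_square algebra_simps)
    then show ?thesis by (simp add: s algebra_simps)
  qed
  have dist: "(f i - f j) \<bullet> (f i - f j) = (if i = j then 0 else 2 * N)" if ij: "i \<le> n" "j \<le> n" for i j
  proof (cases "i < n \<longleftrightarrow> j < n")
    case True
    then show ?thesis using ij
      by (auto simp: f_def inner_diff_left inner_diff_right inner_frame)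
  next
    case False
    then show ?thesis using ij apex[of i] apex[of j] norm_minus_commute[of "e j" "s *\<^sub>R E"]
      by (auto simp: f_def dot_square_norm)
  qed
  \<comment> \<open>Squared distances determine the inner products of differences, so equal
    distances give the whole Gram condition.\<close>
  have polar: "2 * ((a - b) \<bullet> (c - d)) =
      (a - d) \<bullet> (a - d) + (b - c) \<bullet> (b - c) - (a - c) \<bullet> (a - c) - (b - d) \<bullet> (b - d)" for a b c d :: 'a
    by (simp add: inner_diff_left inner_diff_right inner_commute)
  have simplex: "simplex_points f N n"
  proof
    show "(f i - f j) \<bullet> (f k - f l) =
        N * (of_bool (i = k) + of_bool (j = l) - of_bool (i = l) - of_bool (j = k))"
      if "i \<le> n" "j \<le> n" "k \<le> n" "l \<le> n" for i j k l
      using polar[of "f i" "f j" "f k" "f l"] that by (auto simp: dist)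
  qed (rule N_pos)
  let ?U = "span (A_roots f n)"
  have diff: "e i - s *\<^sub>R E \<in> ?U" if "i < n" for i
  proof (rule span_base)
    have "f i - f n \<in> A_roots f n" unfolding A_roots_def using that by fastforce
    then show "e i - s *\<^sub>R E \<in> A_roots f n" using that by (simp add: f_def)
  qed
  \<comment> \<open>This sum is a nonzero multiple of \<open>E\<close>, since
    \<open>1 - real n * s = - sqrt (1 + real n)\<close>. Hence \<open>E\<close> and then every
    \<open>e i\<close> lie in the span of the roots, which gives the dimension bound.\<close>
  have "(\<Sum>i<n. e i - s *\<^sub>R E) \<in> ?U" using diff by (intro span_sum) auto
  moreover have "(\<Sum>i<n. e i - s *\<^sub>R E) = (- sqrt (1 + real n)) *\<^sub>R E"
  proof -
    have "(\<Sum>i<n. e i - s *\<^sub>R E) = (1 - real n * s) *\<^sub>R E"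
      by (simp add: sum_subtractf E_def sum_constant_scaleR algebra_simps)
    then show ?thesis by (simp add: ns)
  qed
  ultimately have "(- 1 / sqrt (1 + real n)) *\<^sub>R (- sqrt (1 + real n)) *\<^sub>R E \<in> ?U"
    by (metis span_scale)
  then have "E \<in> ?U" by simp
  then have "e i \<in> ?U" if "i < n" for i
    using span_add[OF diff[OF that] span_scale[of E _ s]] by simp
  then have "card (e ` {..<n}) \<le> dim ?U"
    using independent_frame by (intro independent_card_le_dim) auto
  then have "n \<le> dim (A_roots f n)" using card_image[OF inj_frame] by simp
  then show thesis using that[of f] simplex by (simp add: f_def)
qed

section \<open>Edge weights and the passage to a diagram of type \<open>A\<close>\<close>

definition edge_weight :: "'a::euclidean_space \<Rightarrow> 'a \<Rightarrow> real" where
  "edge_weight x y = cartan_number x y * cartan_number y x"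

lemma edge_weight_commute: "edge_weight x y = edge_weight y x"
  by (simp add: edge_weight_def mult.commute)

text \<open>The weight is an integer by the crystallographic condition and a square over a
  nonnegative number, so rounding it to a natural multiplicity loses nothing.\<close>

lemma edge_weight_nat:
  assumes "root_system \<Phi>" "x \<in> \<Phi>" "y \<in> \<Phi>"
  shows "real (nat \<lfloor>edge_weight x y\<rfloor>) = edge_weight x y"
proof -
  have "edge_weight x y \<in> \<int>"
    using assms by (auto simp: edge_weight_def root_system_def)
  moreover have "edge_weight x y = (2 * (x \<bullet> y))\<^sup>2 / ((x \<bullet> x) * (y \<bullet> y))"
    by (simp add: edge_weight_def cartan_number_def inner_commute power2_eq_square)
  then have "edge_weight x y \<ge> 0" by simp
  ultimately show ?thesis by (auto elim!: Ints_cases)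
qed

text \<open>Replacing \<open>e r\<close> by \<open>f r - f n\<close> attaches the new point
  \<open>n\<close> as a leaf at \<open>r\<close> to the graph of long labels. Two labels are
  adjacent when they share an endpoint, before and after; only the lengths change, and with them the
  weights at \<open>v\<^sub>0\<close>.\<close>

lemma (in orthogonal_frame) A_type_realization:
  fixes \<Delta> :: "'v diagram" and \<beta> :: "'v \<Rightarrow> 'a"
  assumes n: "n \<ge> 2" and V: "finite (verts \<Delta>)" "card (verts \<Delta>) \<le> n" "v\<^sub>0 \<in> verts \<Delta>"
    and r: "r < n" and \<beta>\<^sub>0: "\<beta> v\<^sub>0 = e r"
    and diffs: "\<And>v. v \<in> verts \<Delta> - {v\<^sub>0} \<Longrightarrow> \<exists>i<n. \<exists>j<n. i \<noteq> j \<and> \<beta> v = e i - e j"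
    and cross: "\<And>K. K \<subseteq> {..<n} \<Longrightarrow> K \<noteq> {} \<Longrightarrow> K \<noteq> {..<n} \<Longrightarrow>
      \<exists>v\<in>verts \<Delta>. (\<exists>i\<in>K. \<beta> v \<bullet> e i \<noteq> 0) \<and> (\<exists>j\<in>{..<n} - K. \<beta> v \<bullet> e j \<noteq> 0)"
    and mult: "\<And>u v. real (mult \<Delta> u v) =
      (if u \<in> verts \<Delta> \<and> v \<in> verts \<Delta> \<and> u \<noteq> v then edge_weight (\<beta> u) (\<beta> v) else 0)"
  shows "\<exists>\<Gamma>. carter_diagram_of_type TYPE('a) n cartan_A \<Gamma> \<and> v\<^sub>0 \<in> verts \<Gamma> \<and>
    diagram_connected (delete_vertex \<Gamma> v\<^sub>0) \<and> \<Delta> = double_at \<Gamma> v\<^sub>0"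
proof -
  let ?V = "verts \<Delta>"
  obtain f where f: "\<And>i. i < n \<Longrightarrow> f i = e i" and simplex: "simplex_points f N n"
    and dim: "n \<le> dim (A_roots f n)"
    using n by (rule_tac simplex_extension) auto
  interpret A: simplex_points f N n by (rule simplex)
  define \<gamma> where "\<gamma> v = (if v = v\<^sub>0 then f r - f n else \<beta> v)" for v
  have \<gamma>\<^sub>0: "\<gamma> v\<^sub>0 = f r - f n" by (simp add: \<gamma>_def)
  have long: "\<exists>i<n. \<exists>j<n. i \<noteq> j \<and> \<beta> v = e i - e j \<and> \<gamma> v = f i - f j"
    if v: "v \<in> ?V - {v\<^sub>0}" for v
  proof -
    obtain i j where "i < n" "j < n" "i \<noteq> j" "\<beta> v = e i - e j" using diffs[OF v] by blast
    moreover from this have "\<gamma> v = f i - f j" using v f by (simp add: \<gamma>_def)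
    ultimately show ?thesis by blast
  qed
  \<comment> \<open>The short label has a single nonzero coordinate, so a crossing label is
    long.\<close>
  have cross': "\<exists>v\<in>?V - {v\<^sub>0}. \<exists>i\<in>K. \<exists>j\<in>{..<n} - K. \<beta> v \<bullet> e i \<noteq> 0 \<and> \<beta> v \<bullet> e j \<noteq> 0"
    if K: "K \<subseteq> {..<n}" "K \<noteq> {}" "K \<noteq> {..<n}" for K
  proof -
    obtain v i j where v: "v \<in> ?V" "i \<in> K" "j \<in> {..<n} - K" "\<beta> v \<bullet> e i \<noteq> 0" "\<beta> v \<bullet> e j \<noteq> 0"
      using cross[OF K] by blast
    have "v \<noteq> v\<^sub>0"
    proof
      assume "v = v\<^sub>0"
      then have "r = i" "r = j"
        using v K r by (auto simp: \<beta>\<^sub>0 inner_frame split: if_splits)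
      then show False using v by simp
    qed
    then show ?thesis using v by blast
  qed
  have \<gamma>_mem: "\<gamma> v \<in> A_roots f n" if v: "v \<in> ?V" for v
  proof (cases "v = v\<^sub>0")
    case True
    then show ?thesis using r by (auto simp: \<gamma>\<^sub>0 intro!: A.A_rootsI)
  next
    case False
    then obtain i j where "i < n" "j < n" "i \<noteq> j" "\<gamma> v = f i - f j" using long[of v] v by blast
    then show ?thesis by (auto intro!: A.A_rootsI)
  qed
  then have \<gamma>_sub: "\<gamma> ` ?V \<subseteq> A_roots f n" by blast
  have hull: "root_subsystem (A_roots f n) hull (\<gamma> ` ?V) = A_roots f n"
  proof (rule A.A_roots_hull[OF \<gamma>_sub])
    fix K assume K: "K \<subseteq> {..n}" "n \<in> K" "K \<noteq> {..n}"
    show "\<exists>i\<in>K. \<exists>j\<in>{..n} - K. f i - f j \<in> \<gamma> ` ?V \<or> f j - f i \<in> \<gamma> ` ?V"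
    \<comment> \<open>The leaf edge joins \<open>n\<close> to \<open>r\<close> and crosses if
      \<open>r\<close> is outside \<open>K\<close>. Otherwise \<open>K - {n}\<close> is a nonempty
      proper set of frame indices, crossed by a long label.\<close>
    proof (cases "r \<in> K")
      case False
      have "f r - f n \<in> \<gamma> ` ?V" using V(3) \<gamma>\<^sub>0 by (metis imageI)
      then show ?thesis using False K(2) r by (intro bexI[of _ n] bexI[of _ r]) auto
    next
      case True
      have "K - {n} \<noteq> {..<n}" using K by (auto simp flip: lessThan_Suc_atMost simp: lessThan_Suc)
      moreover have "K - {n} \<subseteq> {..<n}" "K - {n} \<noteq> {}" using K True r by fastforce+
      ultimately obtain v i j where v: "v \<in> ?V - {v\<^sub>0}" "i \<in> K - {n}" "j \<in> {..<n} - (K - {n})"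
          "\<beta> v \<bullet> e i \<noteq> 0" "\<beta> v \<bullet> e j \<noteq> 0"
        using cross'[of "K - {n}"] by blast
      obtain a b where ab: "a < n" "b < n" "a \<noteq> b" "\<beta> v = e a - e b" "\<gamma> v = f a - f b"
        using long[OF v(1)] by blast
      have "i < n" "j < n" "i \<noteq> j" "j \<notin> K" using v K by force+
      then have "a = i \<and> b = j \<or> a = j \<and> b = i"
        using v(4,5) ab by (auto simp: inner_diff_left inner_frame split: if_splits)
      then have "f i - f j \<in> \<gamma> ` ?V \<or> f j - f i \<in> \<gamma> ` ?V"
        using ab(5) v(1) by (metis DiffD1 imageI)
      then show ?thesis
        using \<open>j \<notin> K\<close> \<open>j < n\<close> v(2) by (intro bexI[of _ i] bexI[of _ j]) auto
    qed
  qed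
  have span: "A_roots f n \<subseteq> span (\<gamma> ` ?V)"
    using root_hull_subset_span[OF A.root_system_A_roots \<gamma>_sub] by (simp add: hull)
  have card_le: "card (\<gamma> ` ?V) \<le> card ?V" using V(1) by (rule card_image_le)
  \<comment> \<open>At most \<open>n\<close> labels span a set of dimension at least
    \<open>n\<close>; this forces both injectivity and independence of the new labels.\<close>
  have "dim (A_roots f n) \<le> card (\<gamma> ` ?V)"
    using span V(1) by (intro dim_le_card) auto
  then have inj: "inj_on \<gamma> ?V"
    using dim card_le V by (intro eq_card_imp_inj_on) auto
  have indep: "independent (\<gamma> ` ?V)"
    using \<gamma>_sub span dim card_le V by (intro card_le_dim_spanning[of _ "A_roots f n"]) auto
  define \<Gamma> where "\<Gamma> = \<lparr>verts = ?V, mult = \<lambda>u v. if u \<in> ?V \<and> v \<in> ?V \<and> u \<noteq> v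
      then nat \<lfloor>edge_weight (\<gamma> u) (\<gamma> v)\<rfloor> else 0\<rparr>"
  have verts_\<Gamma>: "verts \<Gamma> = ?V" by (simp add: \<Gamma>_def)
  have mult_\<Gamma>: "real (mult \<Gamma> u v) =
      (if u \<in> ?V \<and> v \<in> ?V \<and> u \<noteq> v then edge_weight (\<gamma> u) (\<gamma> v) else 0)" for u v
    using edge_weight_nat[OF A.root_system_A_roots] \<gamma>_mem by (simp add: \<Gamma>_def)
  have "is_carter_diagram (A_roots f n) \<gamma> \<Gamma>"
    unfolding is_carter_diagram_def verts_\<Gamma>
    using A.root_system_A_roots \<gamma>_sub inj indep mult_\<Gamma> by (simp add: edge_weight_def)
  then have carter: "carter_diagram_of_type TYPE('a) n cartan_A \<Gamma>"
    unfolding carter_diagram_of_type_def verts_\<Gamma>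
    using A.A_roots_dynkin_type[OF dim] hull
    by (intro exI[of _ "A_roots f n"] exI[of _ \<gamma>]) (simp add: verts_\<Gamma>)
  define R where "R = {(x, y). x \<in> ?V - {v\<^sub>0} \<and> y \<in> ?V - {v\<^sub>0} \<and> mult (delete_vertex \<Gamma> v\<^sub>0) x y \<noteq> 0}"
  \<comment> \<open>Labels with a common endpoint are never orthogonal: their Cartan number is 1 or
    -1 for one shared endpoint, 2 or -2 for two.\<close>
  have adjacent: "(w, x) \<in> R\<^sup>*" if wx: "w \<in> ?V - {v\<^sub>0}" "x \<in> ?V - {v\<^sub>0}"
    and i: "i < n" "\<beta> w \<bullet> e i \<noteq> 0" "\<beta> x \<bullet> e i \<noteq> 0" for w x i
  proof (cases "w = x")
    case False
    obtain a b where ab: "a < n" "b < n" "a \<noteq> b" "\<beta> w = e a - e b" "\<gamma> w = f a - f b"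
      using long[OF wx(1)] by blast
    obtain c d where cd: "c < n" "d < n" "c \<noteq> d" "\<beta> x = e c - e d" "\<gamma> x = f c - f d"
      using long[OF wx(2)] by blast
    have "i = a \<or> i = b" "i = c \<or> i = d"
      using i ab cd by (auto simp: inner_diff_left inner_frame split: if_splits)
    then have "edge_weight (\<gamma> w) (\<gamma> x) \<noteq> 0"
      using ab cd by (auto simp: edge_weight_def A.cartan_diff_diff)
    then have "mult \<Gamma> w x \<noteq> 0"
      using mult_\<Gamma>[of w x] wx False by auto
    then have "(w, x) \<in> R" using wx by (simp add: R_def delete_vertex_def)
    then show ?thesis by (rule r_into_rtrancl)
  qed simp
  have support: "\<exists>i<n. \<beta> v \<bullet> e i \<noteq> 0" if v: "v \<in> ?V - {v\<^sub>0}" for v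
  proof -
    obtain a b where ab: "a < n" "b < n" "a \<noteq> b" "\<beta> v = e a - e b"
      using long[OF v] by blast
    then have "\<beta> v \<bullet> e a \<noteq> 0" using N_pos by (simp add: inner_diff_left inner_frame)
    then show ?thesis using ab by blast
  qed
  have "?V - {v\<^sub>0} \<noteq> {}"
  proof -
    have "{0} \<noteq> {..<n}"
    proof
      assume "{0} = {..<n}"
      moreover have "1 \<in> {..<n}" using n by simp
      ultimately show False by (metis singletonD zero_neq_one)
    qed
    moreover have "{0} \<subseteq> {..<n}" using n by simp
    ultimately have "\<exists>v. v \<in> ?V - {v\<^sub>0}" using cross'[of "{0}"] by blast
    then show ?thesis by blast
  qed
  moreover have "(u, v) \<in> R\<^sup>*" if uv: "u \<in> ?V - {v\<^sub>0}" "v \<in> ?V - {v\<^sub>0}" for u v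
  proof -
    \<comment> \<open>\<open>W\<close> is the component of \<open>u\<close> and \<open>K\<close> the
      set of endpoints of its labels. A label crossing \<open>K\<close> would belong to
      \<open>W\<close> and so have both endpoints in \<open>K\<close>; hence \<open>K\<close> is
      everything and \<open>W\<close> contains \<open>v\<close>.\<close>
    define W where "W = {w \<in> ?V - {v\<^sub>0}. (u, w) \<in> R\<^sup>*}"
    define K where "K = {i. i < n \<and> (\<exists>w\<in>W. \<beta> w \<bullet> e i \<noteq> 0)}"
    have W_closed: "x \<in> W" if "x \<in> ?V - {v\<^sub>0}" "i \<in> K" "\<beta> x \<bullet> e i \<noteq> 0" for x i
    proof -
      obtain w where "w \<in> W" "i < n" "\<beta> w \<bullet> e i \<noteq> 0"
        using \<open>i \<in> K\<close> by (auto simp: K_def)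
      then have "(w, x) \<in> R\<^sup>*" "(u, w) \<in> R\<^sup>*"
        using adjacent[of w x i] that by (auto simp: W_def)
      then show ?thesis using that by (auto simp: W_def intro: rtrancl_trans)
    qed
    have "u \<in> W" using uv by (simp add: W_def)
    then have "K \<noteq> {}" using support[OF uv(1)] by (auto simp: K_def)
    have "K = {..<n}"
    proof (rule ccontr)
      assume "K \<noteq> {..<n}"
      moreover have "K \<subseteq> {..<n}" by (auto simp: K_def)
      ultimately obtain x i j where "x \<in> ?V - {v\<^sub>0}" "i \<in> K" "j \<in> {..<n} - K"
          "\<beta> x \<bullet> e i \<noteq> 0" "\<beta> x \<bullet> e j \<noteq> 0"
        using cross'[of K] \<open>K \<noteq> {}\<close> by blast
      then show False using W_closed[of x i] by (auto simp: K_def)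
    qed
    then have "v \<in> W" using support[OF uv(2)] W_closed[OF uv(2)] by auto
    then show ?thesis by (simp add: W_def)
  qed
  ultimately have connected: "diagram_connected (delete_vertex \<Gamma> v\<^sub>0)"
    unfolding diagram_connected_def R_def by (simp add: delete_vertex_def verts_\<Gamma>)
  \<comment> \<open>Both weights vanish unless \<open>r\<close> is an endpoint of the long label. If
    it is, squared lengths \<open>N\<close> and \<open>2 * N\<close> give weight 2, and equal
    lengths give weight 1.\<close>
  have short: "edge_weight (\<beta> v\<^sub>0) (\<beta> v) = (if edge_weight (\<gamma> v\<^sub>0) (\<gamma> v) = 0 then 0 else 2)"
    if v: "v \<in> ?V - {v\<^sub>0}" for v
  proof -
    obtain a b where ab: "a < n" "b < n" "a \<noteq> b" "\<beta> v = e a - e b" "\<gamma> v = f a - f b"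
      using long[OF v] by blast
    have "(e a - e b) \<bullet> (e a - e b) = 2 * N" "e r \<bullet> e r = N"
      "e r \<bullet> (e a - e b) = N * (of_bool (r = a) - of_bool (r = b))"
      using ab r by (simp_all add: inner_diff_left inner_diff_right inner_frame)
    then have "edge_weight (\<beta> v\<^sub>0) (\<beta> v) = 2 * (of_bool (r = a) - of_bool (r = b))\<^sup>2"
      using N_pos ab by (simp add: edge_weight_def cartan_number_def \<beta>\<^sub>0
          inner_commute[of "e a - e b" "e r"] power2_eq_square)
    moreover have "edge_weight (\<gamma> v\<^sub>0) (\<gamma> v) = (of_bool (r = a) - of_bool (r = b))\<^sup>2"
      using ab r by (auto simp: edge_weight_def \<gamma>\<^sub>0 A.cartan_diff_diff power2_eq_square)
    ultimately show ?thesis using ab by auto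
  qed
  have "mult \<Delta> u v = mult (double_at \<Gamma> v\<^sub>0) u v" for u v
  proof (cases "u \<in> ?V \<and> v \<in> ?V \<and> u \<noteq> v")
    case False
    then have "mult \<Delta> u v = 0" "mult \<Gamma> u v = 0"
      using mult[of u v] mult_\<Gamma>[of u v] by auto
    then show ?thesis by (simp add: double_at_def)
  next
    case True
    consider "u = v\<^sub>0" | "v = v\<^sub>0" | "u \<noteq> v\<^sub>0" "v \<noteq> v\<^sub>0" by blast
    then have "real (mult \<Delta> u v) = real (mult (double_at \<Gamma> v\<^sub>0) u v)"
    proof cases
      case 1
      then show ?thesis using True mult[of u v] mult_\<Gamma>[of u v] short[of v]
        by (auto simp: double_at_def split: if_splits)
    next
      case 2
      then show ?thesis using True mult[of u v] mult_\<Gamma>[of u v] short[of u]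
        by (auto simp: double_at_def edge_weight_commute[of _ "\<beta> v\<^sub>0"]
            edge_weight_commute[of _ "\<gamma> v\<^sub>0"] split: if_splits)
    next
      case 3
      then show ?thesis using True mult[of u v] mult_\<Gamma>[of u v]
        by (simp add: double_at_def \<gamma>_def)
    qed
    then show ?thesis by simp
  qed
  then have "\<Delta> = double_at \<Gamma> v\<^sub>0"
    by (intro diagram.equality ext) (simp_all add: double_at_def verts_\<Gamma>)
  then show ?thesis using carter connected V(3) verts_\<Gamma> by blast
qed

section \<open>From type \<open>B\<close> to type \<open>A\<close>\<close>

theorem theorem2p21:
  fixes n :: nat and \<Delta> :: "'v diagram"
  assumes "n \<ge> 2"
    and "carter_diagram_of_type TYPE('a::euclidean_space) n (cartan_B n) \<Delta>"
  shows "\<exists>\<Gamma> v. carter_diagram_of_type TYPE('a) n cartan_A \<Gamma> \<and>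
           v \<in> verts \<Gamma> \<and> diagram_connected (delete_vertex \<Gamma> v) \<and>
           \<Delta> = double_at \<Gamma> v"
proof -
  let ?V = "verts \<Delta>"
  obtain \<Phi> :: "'a set" and \<beta> where carter: "is_carter_diagram \<Phi> \<beta> \<Delta>"
    and type: "has_dynkin_type (root_subsystem \<Phi> hull (\<beta> ` ?V)) n (cartan_B n)"
    using assms(2) unfolding carter_diagram_of_type_def by (elim exE conjE)
  have \<Phi>: "root_system \<Phi>" "\<beta> ` ?V \<subseteq> \<Phi>" and inj: "inj_on \<beta> ?V" and indep: "independent (\<beta> ` ?V)"
    and mult: "real (mult \<Delta> u v) =
      (if u \<in> ?V \<and> v \<in> ?V \<and> u \<noteq> v then edge_weight (\<beta> u) (\<beta> v) else 0)" for u v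
    using carter by (simp_all add: is_carter_diagram_def edge_weight_def)
  define \<Psi> where "\<Psi> = root_subsystem \<Phi> hull (\<beta> ` ?V)"
  have \<Psi>_sub: "root_subsystem \<Phi> \<Psi>" unfolding \<Psi>_def using \<Phi> by (rule root_subsystem_hull)
  then have \<Psi>: "root_system \<Psi>" and "\<Psi> \<subseteq> \<Phi>" by (auto simp: root_subsystem_def)
  have \<beta>_mem: "\<beta> v \<in> \<Psi>" if "v \<in> ?V" for v
    unfolding \<Psi>_def using that by (intro hull_inc) blast
  obtain e N where frame: "orthogonal_frame e N n" and "\<forall>i<n. e i \<in> \<Psi>"
    and "\<forall>i. Suc i < n \<longrightarrow> e i - e (Suc i) \<in> \<Psi>"
    and "\<forall>x\<in>\<Psi>. \<exists>c::nat \<Rightarrow> int. x = (\<Sum>i<n. of_int (c i) *\<^sub>R e i)"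
    using B_type_frame[OF \<Psi> assms(1) type[folded \<Psi>_def]] by (elim exE conjE)
  note e_mem = this(2)[rule_format] and simple = this(3)[rule_format] and coords = this(4)[rule_format]
  interpret orthogonal_frame e N n by (rule frame)
  have real_coords: "\<exists>c. x = (\<Sum>i<n. c i *\<^sub>R e i)" if x: "x \<in> \<Psi>" for x
  proof -
    obtain c :: "nat \<Rightarrow> int" where "x = (\<Sum>i<n. of_int (c i) *\<^sub>R e i)"
      using coords[OF x] by (elim exE)
    then show ?thesis by (rule exI[where x = "\<lambda>i. of_int (c i)"])
  qed
  have form: "(\<exists>i<n. \<exists>s\<in>{1,-1}. x = s *\<^sub>R e i) \<or>
    (\<exists>i<n. \<exists>j<n. i \<noteq> j \<and> (\<exists>s\<in>{1,-1}. \<exists>t\<in>{1,-1}. x = s *\<^sub>R e i + t *\<^sub>R e j))" if x: "x \<in> \<Psi>" for x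
  proof -
    obtain c :: "nat \<Rightarrow> int" where c: "x = (\<Sum>i<n. of_int (c i) *\<^sub>R e i)"
      using coords[OF x] by (elim exE)
    show ?thesis by (rule integral_root_form[OF \<Psi> _ x c]) (rule e_mem)
  qed
  have finite: "finite ?V"
    using finite_imageD[OF independent_imp_finite[OF indep] inj] .
  have "\<beta> ` ?V \<subseteq> span (e ` {..<n})"
  proof (rule image_subsetI)
    fix v assume "v \<in> ?V"
    then obtain c where "\<beta> v = (\<Sum>i<n. c i *\<^sub>R e i)" using real_coords[OF \<beta>_mem] by blast
    then show "\<beta> v \<in> span (e ` {..<n})" by (auto intro: span_sum span_scale span_base)
  qed
  then have "card (\<beta> ` ?V) \<le> card (e ` {..<n})"
    using independent_span_bound[OF _ indep, of "e ` {..<n}"] by simp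
  then have card: "card ?V \<le> n"
    by (simp add: card_image[OF inj] card_image[OF inj_frame])
  text \<open>Reflections preserve lengths, so a hull containing the short root \<open>e 0\<close> is not
    generated by long roots alone.\<close>
  have "\<exists>v\<in>?V. \<beta> v \<bullet> \<beta> v = N"
  proof (rule ccontr)
    assume no_short: "\<not> ?thesis"
    have "root_subsystem \<Psi> {x \<in> \<Psi>. x \<bullet> x \<noteq> N}"
    proof (rule root_subsystemI[OF \<Psi>])
      fix x y assume xy: "x \<in> {x \<in> \<Psi>. x \<bullet> x \<noteq> N}" "y \<in> {x \<in> \<Psi>. x \<bullet> x \<noteq> N}"
      then have "x \<noteq> 0" "y - cartan_number y x *\<^sub>R x \<in> \<Psi>"
        using \<Psi> by (auto simp: root_system_def)
      then show "y - cartan_number y x *\<^sub>R x \<in> {x \<in> \<Psi>. x \<bullet> x \<noteq> N}"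
        using xy reflection_norm_invariant[of x y] by simp
    qed auto
    then have "root_subsystem \<Phi> {x \<in> \<Psi>. x \<bullet> x \<noteq> N}"
      using \<open>\<Psi> \<subseteq> \<Phi>\<close> by (auto simp: root_subsystem_def)
    moreover have "\<beta> ` ?V \<subseteq> {x \<in> \<Psi>. x \<bullet> x \<noteq> N}" using no_short \<beta>_mem by auto
    ultimately have "\<Psi> \<subseteq> {x \<in> \<Psi>. x \<bullet> x \<noteq> N}"
      unfolding \<Psi>_def by (rule_tac hull_minimal)
    then have "e 0 \<bullet> e 0 \<noteq> N" using e_mem[of 0] assms(1) by auto
    then show False using inner_frame[of 0 0] assms(1) by simp
  qed
  then obtain v\<^sub>0 where v\<^sub>0: "v\<^sub>0 \<in> ?V" "\<beta> v\<^sub>0 \<bullet> \<beta> v\<^sub>0 = N" by blast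
  \<comment> \<open>Squared length separates the two shapes of roots: \<open>N\<close> for one
    coordinate, \<open>2 * N\<close> for two.\<close>
  have "\<exists>r<n. \<exists>s\<in>{1,-1}. \<beta> v\<^sub>0 = s *\<^sub>R e r"
  proof (rule ccontr)
    assume "\<not> ?thesis"
    then obtain i j s t where "i < n" "j < n" "i \<noteq> j" "s \<in> {1,-1}" "t \<in> {1,-1}"
      "\<beta> v\<^sub>0 = s *\<^sub>R e i + t *\<^sub>R e j"
      using form[OF \<beta>_mem[OF v\<^sub>0(1)]] by blast
    then have "\<beta> v\<^sub>0 \<bullet> \<beta> v\<^sub>0 = 2 * N"
      by (auto simp: inner_add_left inner_add_right inner_diff_left inner_diff_right inner_frame)
    then show False using v\<^sub>0(2) N_pos by simp
  qed
  then obtain r s\<^sub>0 where r: "r < n" "s\<^sub>0 \<in> {1,-1}" "\<beta> v\<^sub>0 = s\<^sub>0 *\<^sub>R e r" by blast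
  have cross: "\<exists>v\<in>?V. (\<exists>i\<in>K. \<beta> v \<bullet> e i \<noteq> 0) \<and> (\<exists>j\<in>{..<n} - K. \<beta> v \<bullet> e j \<noteq> 0)"
    if "K \<subseteq> {..<n}" "K \<noteq> {}" "K \<noteq> {..<n}" for K
    using root_hull_crosses[OF \<Phi> \<Psi>_def real_coords simple that] by simp
  \<comment> \<open>A crossing label has two nonzero coordinates, and the classification of roots
    allows no more.\<close>
  have cross_form: "\<exists>v\<in>?V. \<exists>i\<in>K. \<exists>j\<in>{..<n} - K. \<exists>s\<in>{1,-1}. \<exists>t\<in>{1,-1}. \<beta> v = s *\<^sub>R e i + t *\<^sub>R e j"
    if K: "K \<subseteq> {..<n}" "K \<noteq> {}" "K \<noteq> {..<n}" for K
  proof -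
    obtain v i j where v: "v \<in> ?V" "i \<in> K" "j \<in> {..<n} - K" "\<beta> v \<bullet> e i \<noteq> 0" "\<beta> v \<bullet> e j \<noteq> 0"
      using cross[OF K] by blast
    have ij: "i < n" "j < n" "i \<noteq> j" using v K by auto
    have "\<exists>s\<in>{1,-1}. \<exists>t\<in>{1,-1}. \<beta> v = s *\<^sub>R e i + t *\<^sub>R e j"
      using form[OF \<beta>_mem[OF v(1)]]
    proof (elim disjE exE conjE bexE)
      fix m s assume "m < n" "\<beta> v = s *\<^sub>R e m"
      then have "m = i" "m = j" using v(4,5) ij by (auto simp: inner_frame split: if_splits)
      then show ?thesis using ij by simp
    next
      fix a b s t
      assume ab: "a < n" "b < n" "a \<noteq> b" "s \<in> {1,-1}" "t \<in> {1,-1}" "\<beta> v = s *\<^sub>R e a + t *\<^sub>R e b"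
      then have "i = a \<and> j = b \<or> i = b \<and> j = a"
        using v(4,5) ij by (auto simp: inner_add_left inner_diff_left inner_frame split: if_splits)
      then show ?thesis
      proof
        assume "i = b \<and> j = a"
        then show ?thesis
          using ab by (intro bexI[of _ t] bexI[of _ s]) (simp_all add: add.commute)
      qed (use ab in blast)
    qed
    then show ?thesis using v by blast
  qed
  obtain \<epsilon> where \<epsilon>: "\<And>i. \<epsilon> i \<in> {1, -1::real}" "\<epsilon> r = s\<^sub>0"
    and diffs: "\<And>v. v \<in> ?V - {v\<^sub>0} \<Longrightarrow> \<exists>i<n. \<exists>j<n. i \<noteq> j \<and> \<beta> v = \<epsilon> i *\<^sub>R e i - \<epsilon> j *\<^sub>R e j"
    using signed_tree[OF finite card v\<^sub>0(1) r cross_form] by blast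
  have \<epsilon>_nonzero: "\<epsilon> i \<noteq> 0" "\<epsilon> i * \<epsilon> i = 1" for i using \<epsilon>(1)[of i] by auto
  \<comment> \<open>The signs are absorbed into the frame: since they square to 1, it stays
    orthogonal with the same \<open>N\<close>, and the labels become \<open>e' r\<close> and
    differences \<open>e' i - e' j\<close>.\<close>
  define e' where "e' i = \<epsilon> i *\<^sub>R e i" for i
  interpret signed: orthogonal_frame e' N n
    by unfold_locales (auto simp: e'_def N_pos inner_frame \<epsilon>_nonzero simp flip: mult.assoc)
  have "\<exists>\<Gamma>. carter_diagram_of_type TYPE('a) n cartan_A \<Gamma> \<and> v\<^sub>0 \<in> verts \<Gamma> \<and>
      diagram_connected (delete_vertex \<Gamma> v\<^sub>0) \<and> \<Delta> = double_at \<Gamma> v\<^sub>0"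
  proof (rule signed.A_type_realization[OF assms(1) finite card v\<^sub>0(1) r(1)])
    show "\<beta> v\<^sub>0 = e' r" using r(3) \<epsilon>(2) by (simp add: e'_def)
    show "\<exists>i<n. \<exists>j<n. i \<noteq> j \<and> \<beta> v = e' i - e' j" if "v \<in> ?V - {v\<^sub>0}" for v
      using diffs[OF that] by (simp add: e'_def)
    show "\<exists>v\<in>?V. (\<exists>i\<in>K. \<beta> v \<bullet> e' i \<noteq> 0) \<and> (\<exists>j\<in>{..<n} - K. \<beta> v \<bullet> e' j \<noteq> 0)"
      if "K \<subseteq> {..<n}" "K \<noteq> {}" "K \<noteq> {..<n}" for K
      using cross[OF that] \<epsilon>_nonzero by (simp add: e'_def)
  qed (rule mult)
  then show ?thesis by blast
qed

end
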